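(* Fix integers $s,t\ge 3$ with $R(s-1,t)\ge R(s,t-1)$, and set $M=R(s-1,t)$ and $m=R(s,t-1)$. Then for every positive integer $r$, $$R^{\mathrm{KG}}_r(s,t)\le (M+1)r+m-1.$$ In particular, for every $s\ge 3$ and every positive integer $r$, $R^{\mathrm{KG}}_r(s,s)\le (R(s,s-1)+1)r+R(s,s-1)-1$.
   Context: $R(s,t)$ is the classical Ramsey number: the least $n$ such that every red/blue edge-coloring of $K_n$ contains a red $K_s$ or a blue $K_t$. The Kneser graph $\mathrm{KG}(n,r)$ has vertex set the $r$-element subsets of $[n]=\{1,\dots,n\}$, with two sets adjacent iff they are disjoint. The $r$-Kneser Ramsey number $R^{\mathrm{KG}}_r(s,t)$ is the minimum integer $n$ such that every red/blue edge-coloring of $\mathrm{KG}(n,r)$ contains a red $K_s$ (a set of $s$ pairwise adjacent vertices with all connecting edges red) or a blue $K_t$. *)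

theory Defs
  imports "HOL-Library.Ramsey"
begin

datatype colour = Red | Blue

text \<open>
  A simple graph on vertex set \<open>V\<close> is given by its set \<open>E\<close> of edges, each a two-element subset
  of \<open>V\<close>. Colourings are total functions on sets, but only their values on the members of \<open>E\<close>
  matter, so quantifying over them amounts to quantifying over all colourings of \<open>E\<close>.
\<close>

definition mono_clique ::
    "'a set \<Rightarrow> 'a set set \<Rightarrow> ('a set \<Rightarrow> colour) \<Rightarrow> colour \<Rightarrow> nat \<Rightarrow> bool" where
  "mono_clique V E c i k \<longleftrightarrow> (\<exists>K \<in> nsets V k. clique K {e \<in> E. c e = i})"

definition arrows :: "'a set \<Rightarrow> 'a set set \<Rightarrow> nat \<Rightarrow> nat \<Rightarrow> bool" where
  "arrows V E s t \<longleftrightarrow> (\<forall>c. mono_clique V E c Red s \<or> mono_clique V E c Blue t)"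

definition ramsey_number :: "nat \<Rightarrow> nat \<Rightarrow> nat" where
  "ramsey_number s t = (LEAST n. arrows {1..n} (nsets {1..n} 2) s t)"

definition kneser_verts :: "nat \<Rightarrow> nat \<Rightarrow> nat set set" where
  "kneser_verts n r = nsets {1..n} r"

text \<open>For \<open>r > 0\<close> disjoint \<open>r\<close>-sets are automatically distinct; only the degenerate case
  \<open>r = 0\<close> would produce a loop.\<close>

definition kneser_edges :: "nat \<Rightarrow> nat \<Rightarrow> nat set set set" where
  "kneser_edges n r =
     {{A, B} | A B. A \<in> kneser_verts n r \<and> B \<in> kneser_verts n r \<and> A \<inter> B = {}}"

definition kneser_ramsey_number :: "nat \<Rightarrow> nat \<Rightarrow> nat \<Rightarrow> nat" where
  "kneser_ramsey_number r s t = (LEAST n. arrows (kneser_verts n r) (kneser_edges n r) s t)"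

text \<open>The two minima are over nonempty sets, so \<^const>\<open>Least\<close> yields genuine minima.\<close>

lemma arrows_embed:
  assumes "arrows V E s t" and inj: "inj_on f V" and fV: "f ` V \<subseteq> V'"
    and fE: "\<And>x y. x \<in> V \<Longrightarrow> y \<in> V \<Longrightarrow> {x, y} \<in> E \<Longrightarrow> {f x, f y} \<in> E'"
  shows "arrows V' E' s t"
  unfolding arrows_def
proof
  fix c
  have *: "mono_clique V' E' c i k" if "mono_clique V E (\<lambda>e. c (f ` e)) i k" for i k
  proof -
    from that obtain K where K: "K \<in> nsets V k" "clique K {e \<in> E. c (f ` e) = i}"
      by (auto simp: mono_clique_def)
    have sub: "K \<subseteq> V" and fin: "finite K" and card: "card K = k"
      using K(1) by (auto simp: nsets_def)
    have "f ` K \<in> nsets V' k"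
      using sub fin card fV card_image[OF inj_on_subset[OF inj sub]] by (auto simp: nsets_def)
    moreover have "clique (f ` K) {e \<in> E'. c e = i}"
      using K(2) sub fE by (fastforce simp: clique_def)
    ultimately show ?thesis
      by (auto simp: mono_clique_def)
  qed
  show "mono_clique V' E' c Red s \<or> mono_clique V' E' c Blue t"
    using assms(1) * unfolding arrows_def by blast
qed

lemma ex_arrows_complete: "\<exists>n\<ge>1. arrows {1..n::nat} (nsets {1..n} 2) s t"
proof -
  obtain N where N: "N \<ge> 1"
    "\<And>(V :: nat set) E. finite V \<Longrightarrow> N \<le> card V \<Longrightarrow>
       \<exists>K \<subseteq> V. card K = s \<and> clique K E \<or> card K = t \<and> indep K E"
    using ramsey2[of s t] by metis
  have "arrows {1..N} (nsets {1..N} 2) s t"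
    unfolding arrows_def
  proof
    fix c
    obtain K where K: "K \<subseteq> {1..N}"
      "card K = s \<and> clique K {e. c e = Red} \<or> card K = t \<and> indep K {e. c e = Red}"
      using N(2)[of "{1..N}" "{e. c e = Red}"] by auto
    have "finite K"
      using K(1) finite_subset by blast
    have col: "c e \<noteq> Red \<longleftrightarrow> c e = Blue" for e
      by (cases "c e") auto
    show "mono_clique {1..N} (nsets {1..N} 2) c Red s \<or> mono_clique {1..N} (nsets {1..N} 2) c Blue t"
      using K(2)
    proof
      assume "card K = s \<and> clique K {e. c e = Red}"
      then have "K \<in> nsets {1..N} s \<and> clique K {e \<in> nsets {1..N} 2. c e = Red}"
        using K(1) \<open>finite K\<close> unfolding nsets_def[of _ s] clique_def by auto
      then show ?thesis unfolding mono_clique_def by blast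
    next
      assume "card K = t \<and> indep K {e. c e = Red}"
      then have "K \<in> nsets {1..N} t \<and> clique K {e \<in> nsets {1..N} 2. c e = Blue}"
        using K(1) \<open>finite K\<close> unfolding nsets_def[of _ t] clique_def indep_def by (auto simp: col)
      then show ?thesis unfolding mono_clique_def by blast
    qed
  qed
  with N(1) show ?thesis by blast
qed

lemma ex_arrows_kneser:
  assumes "r > 0"
  shows "\<exists>n. arrows (kneser_verts n r) (kneser_edges n r) s t"
proof -
  obtain n where n: "arrows {1..n::nat} (nsets {1..n} 2) s t"
    using ex_arrows_complete by blast
  define f where "f i = {(i - 1) * r + 1..i * r}" for i
  have disj: "f i \<inter> f j = {}" if "i < j" for i j
  proof -
    have "i * r \<le> (j - 1) * r" using that by (intro mult_right_mono) auto
    moreover have "x \<le> i * r" "(j - 1) * r < x" if "x \<in> f i \<inter> f j" for x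
      using that unfolding f_def by auto
    ultimately show ?thesis by (meson disjoint_iff IntI le_trans leD)
  qed
  have disj': "f i \<inter> f j = {}" if "i \<noteq> j" for i j
    using that disj[of i j] disj[of j i] by (cases i j rule: linorder_cases) auto
  have card: "card (f i) = r" if "i \<in> {1..n}" for i
    using that by (cases i) (auto simp: f_def)
  have sub: "f i \<in> kneser_verts (n * r) r" if "i \<in> {1..n}" for i
  proof -
    have "i * r \<le> n * r" using that by (intro mult_right_mono) auto
    then have "f i \<subseteq> {1..n * r}"
      unfolding f_def by (intro iffD2[OF atLeastatMost_subset_iff] disjI2 conjI) simp_all
    then show ?thesis
      using card[OF that] by (auto simp: kneser_verts_def nsets_def f_def)
  qed
  have "inj_on f {1..n}"
  proof (rule inj_onI, rule ccontr)
    fix x y assume "x \<in> {1..n}" "f x = f y" "x \<noteq> y"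
    then have "f x = {}" using disj'[of x y] by auto
    then show False using card[OF \<open>x \<in> {1..n}\<close>] assms by auto
  qed
  then have "arrows (kneser_verts (n * r) r) (kneser_edges (n * r) r) s t"
  proof (rule arrows_embed[OF n])
    show "f ` {1..n} \<subseteq> kneser_verts (n * r) r" using sub by blast
    fix x y assume "x \<in> {1..n}" "y \<in> {1..n}" "{x, y} \<in> nsets {1..n} 2"
    then show "{f x, f y} \<in> kneser_edges (n * r) r"
      using sub[of x] sub[of y] disj'[of x y] unfolding kneser_edges_def by auto
  qed
  then show ?thesis by blast
qed

lemma arrows_ramsey_number:
  "arrows {1..ramsey_number s t} (nsets {1..ramsey_number s t} 2) s t"
  unfolding ramsey_number_def by (rule LeastI_ex) (use ex_arrows_complete in blast)

lemma arrows_kneser_ramsey_number: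
  assumes "r > 0"
  shows "arrows (kneser_verts (kneser_ramsey_number r s t) r)
           (kneser_edges (kneser_ramsey_number r s t) r) s t"
  unfolding kneser_ramsey_number_def by (rule LeastI_ex) (rule ex_arrows_kneser[OF assms])

end

theory Submission
  imports Defs
begin

text \<open>
  Fix a vertex \<open>A\<close> and colour the \<open>r\<close>-subsets of the remaining \<open>M r + m - 1\<close> points by the colour
  of their edge to \<open>A\<close>. It suffices to find \<open>M\<close> pairwise disjoint red sets or \<open>m\<close> pairwise disjoint
  blue ones, since they span a complete subgraph to which \<open>R(s-1,t)\<close> or \<open>R(s,t-1)\<close> applies. Such a
  family exists by induction on \<open>m\<close>: unless the colouring is constant, some red and some blue set
  differ in a single element; remove their union, which has \<open>r + 1\<close> points, and decrease both
  \<open>M\<close> and \<open>m\<close> by one.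
\<close>

text \<open>Walk from \<open>A\<close> to \<open>B\<close>, exchanging one element at a time. Since
  \<open>P\<close> holds at the start and fails at the end, it changes at some exchange, and the
  sets before and after that exchange have a union of size at most \<open>r + 1\<close>.\<close>

lemma nsets_exchange:
  assumes A: "A \<in> nsets X r" "P A" and B: "B \<in> nsets X r" "\<not> P B"
  shows "\<exists>A \<in> nsets X r. \<exists>B \<in> nsets X r. P A \<and> \<not> P B \<and> card (A \<union> B) \<le> Suc r"
  using A
proof (induction "card (A - B)" arbitrary: A rule: less_induct)
  case less
  have fin: "finite A" "finite B" and card: "card A = r" "card B = r" and sub: "A \<subseteq> X" "B \<subseteq> X"
    using less.prems(1) B(1) by (auto simp: nsets_def)
  have "A \<noteq> B" using less.prems B by blast
  then obtain x y where x: "x \<in> A" "x \<notin> B" and y: "y \<in> B" "y \<notin> A"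
    using card_subset_eq[of A B] card_subset_eq[of B A] fin card by auto
  \<comment> \<open>One exchange towards \<open>B\<close>: either \<open>P\<close> fails already at
    \<open>A'\<close>, or the walk goes on from \<open>A'\<close>, which has fewer elements outside
    \<open>B\<close>.\<close>
  define A' where "A' = insert y (A - {x})"
  have A': "A' \<in> nsets X r"
    using fin card sub x y card_Suc_Diff1[OF fin(1) x(1)] by (auto simp: A'_def nsets_def)
  show ?case
  proof (cases "P A'")
    case True
    have "A' - B \<subset> A - B" using x y by (auto simp: A'_def)
    then have "card (A' - B) < card (A - B)" using fin by (simp add: psubset_card_mono)
    then show ?thesis using less.hyps A' True by blast
  next
    case False
    have "A \<union> A' = insert y A" using x by (auto simp: A'_def)
    then have "card (A \<union> A') \<le> Suc r" using fin card y by simp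
    then show ?thesis using less.prems A' False by blast
  qed
qed

text \<open>The extension step of both inductions below. Positivity of \<open>r\<close> makes
  \<open>A\<close> nonempty, hence different from every member of \<open>F\<close>, so the size
  really grows.\<close>

lemma insert_disjoint_family:
  assumes F: "F \<subseteq> nsets Y r" "card F = k" "finite F" "pairwise disjnt F"
    and A: "A \<in> nsets X r" and Y: "Y \<subseteq> X - A" and r: "r > 0"
  shows "insert A F \<subseteq> nsets X r" "card (insert A F) = Suc k" "finite (insert A F)"
    "pairwise disjnt (insert A F)"
proof -
  have disj: "disjnt A B" if "B \<in> F" for B
    using that F(1) Y by (force simp: nsets_def disjnt_def)
  have "A \<noteq> {}" using A r by (auto simp: nsets_def)
  then have "A \<notin> F" using disj by (auto simp: disjnt_def)
  then show "card (insert A F) = Suc k" using F by simp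
  show "insert A F \<subseteq> nsets X r" using A F(1) Y by (fastforce simp: nsets_def)
  show "finite (insert A F)" using F by simp
  show "pairwise disjnt (insert A F)"
    using F(4) disj by (auto simp: pairwise_insert disjnt_sym)
qed

text \<open>Greedy choice: each removed \<open>r\<close>-set leaves enough points for the remaining
  ones. This serves the case of a constant colouring.\<close>

lemma ex_disjoint_family:
  assumes "finite X" "k * r \<le> card X" "r > 0"
  shows "\<exists>F \<subseteq> nsets X r. card F = k \<and> finite F \<and> pairwise disjnt F"
  using assms
proof (induction k arbitrary: X)
  case 0
  show ?case by (intro exI[of _ "{}"]) simp
next
  case (Suc k)
  then have "r \<le> card X" by simp
  then obtain A where A: "A \<subseteq> X" "card A = r" "finite A"
    by (rule obtain_subset_with_card_n)
  then have AX: "A \<in> nsets X r" by (simp add: nsets_def)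
  have "k * r \<le> card (X - A)" using Suc.prems A by (simp add: card_Diff_subset)
  then obtain F where "F \<subseteq> nsets (X - A) r" "card F = k" "finite F" "pairwise disjnt F"
    using Suc by blast
  from insert_disjoint_family[OF this AX order_refl Suc.prems(3)] show ?case by blast
qed

text \<open>The hypothesis on \<open>card X\<close> avoids the truncated subtraction in \<open>a r + b - 1 \<le> |X|\<close>.\<close>

lemma disjoint_family_two_colours:
  assumes "finite X" "b \<le> a" "a * r + b \<le> Suc (card X)" "r > 0"
  shows "(\<exists>F \<subseteq> nsets X r. card F = a \<and> finite F \<and> pairwise disjnt F \<and> (\<forall>A \<in> F. P A)) \<or>
         (\<exists>F \<subseteq> nsets X r. card F = b \<and> finite F \<and> pairwise disjnt F \<and> (\<forall>A \<in> F. \<not> P A))"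
  using assms
proof (induction b arbitrary: a X)
  case 0
  show ?case by (intro disjI2 exI[of _ "{}"]) simp
next
  case (Suc b)
  obtain a' where a: "a = Suc a'" using Suc.prems(2) by (cases a) auto
  show ?case
  proof (cases "\<exists>A \<in> nsets X r. \<exists>B \<in> nsets X r. P A \<and> \<not> P B")
    case True
    then obtain A B where AB: "A \<in> nsets X r" "B \<in> nsets X r" "P A" "\<not> P B"
      and card: "card (A \<union> B) \<le> Suc r"
      using nsets_exchange[of _ X r P] by blast
    let ?Y = "X - (A \<union> B)"
    have "finite (A \<union> B)" "A \<union> B \<subseteq> X" using AB by (auto simp: nsets_def)
    then have "card X = card ?Y + card (A \<union> B)"
      using Suc.prems(1) by (metis card_Diff_subset card_mono le_add_diff_inverse2)
    \<comment> \<open>Lowering both \<open>a\<close> and \<open>b\<close> by one lowers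
      \<open>a * r + b\<close> by \<open>r + 1\<close>, which is at least the number of points
      removed.\<close>
    then have "a' * r + b \<le> Suc (card ?Y)" using Suc.prems(3) card a by simp
    from Suc.IH[OF _ _ this Suc.prems(4)] Suc.prems a
    consider
      F where "F \<subseteq> nsets ?Y r" "card F = a'" "finite F" "pairwise disjnt F" "\<forall>A \<in> F. P A"
      | F where "F \<subseteq> nsets ?Y r" "card F = b" "finite F" "pairwise disjnt F" "\<forall>A \<in> F. \<not> P A"
      by auto
    then show ?thesis
    proof cases
      case 1
      then show ?thesis
        using insert_disjoint_family[OF 1(1-4) AB(1) _ Suc.prems(4)] AB(3) a
        by (intro disjI1 exI[of _ "insert A F"]) auto
    next
      case 2
      then show ?thesis
        using insert_disjoint_family[OF 2(1-4) AB(2) _ Suc.prems(4)] AB(4)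
        by (intro disjI2 exI[of _ "insert B F"]) auto
    qed
  next
    case False
    \<comment> \<open>All \<open>r\<close>-sets now have the same colour, but either colour is
      possible, so a family is built for each; \<open>Suc b \<le> a\<close> leaves room for the
      second.\<close>
    have "a * r \<le> card X" using Suc.prems(3) by simp
    moreover have "Suc b * r \<le> a * r" using Suc.prems(2) by (rule mult_le_mono1)
    ultimately have le: "a * r \<le> card X" "Suc b * r \<le> card X" by simp_all
    obtain F where F: "F \<subseteq> nsets X r" "card F = a" "finite F" "pairwise disjnt F"
      using ex_disjoint_family[OF Suc.prems(1) le(1) Suc.prems(4)] by blast
    obtain G where G: "G \<subseteq> nsets X r" "card G = Suc b" "finite G" "pairwise disjnt G"
      using ex_disjoint_family[OF Suc.prems(1) le(2) Suc.prems(4)] by blast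
    from False have "(\<forall>A \<in> F. P A) \<or> (\<forall>A \<in> G. \<not> P A)" using F(1) G(1) by blast
    with F G show ?thesis by blast
  qed
qed

lemma mono_clique_mono:
  assumes "mono_clique F E c i k" "F \<subseteq> V"
  shows "mono_clique V E c i k"
  using assms by (auto simp: mono_clique_def dest: subsetD[OF nsets_mono])

lemma mono_clique_insert:
  assumes "mono_clique F E c i k" and "F \<subseteq> V" "v \<in> V" "v \<notin> F"
    and "\<And>w. w \<in> F \<Longrightarrow> {v, w} \<in> E \<and> c {v, w} = i"
  shows "mono_clique V E c i (Suc k)"
proof -
  from assms(1) obtain K where K: "K \<in> nsets F k" "clique K {e \<in> E. c e = i}"
    unfolding mono_clique_def by blast
  have "insert v K \<in> nsets V (Suc k)"
    using K(1) assms(2-4) by (auto simp: nsets_def card_insert_if)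
  moreover have "clique (insert v K) {e \<in> E. c e = i}"
    using K assms(5) by (auto simp: clique_def nsets_def insert_commute)
  ultimately show ?thesis unfolding mono_clique_def by blast
qed

text \<open>Pairwise disjoint sets span a complete subgraph of the Kneser graph, so any bijection
  from \<open>{1..ramsey_number s t}\<close> onto \<open>F\<close> transports the classical Ramsey
  property.\<close>

lemma arrows_disjoint_family:
  assumes F: "F \<subseteq> kneser_verts n r" "card F = ramsey_number s t" "finite F" "pairwise disjnt F"
  shows "arrows F (kneser_edges n r) s t"
proof -
  obtain f where f: "bij_betw f {1..ramsey_number s t} F"
    using finite_same_card_bij[of "{1..ramsey_number s t}" F] F by auto
  show ?thesis
  proof (rule arrows_embed[OF arrows_ramsey_number])
    show inj: "inj_on f {1..ramsey_number s t}" and "f ` {1..ramsey_number s t} \<subseteq> F"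
      using f by (auto simp: bij_betw_def)
    fix x y
    assume xy: "x \<in> {1..ramsey_number s t}" "y \<in> {1..ramsey_number s t}"
      and e: "{x, y} \<in> nsets {1..ramsey_number s t} 2"
    have "x \<noteq> y" using e by (auto simp: nsets_def)
    then have "f x \<noteq> f y" using xy inj by (auto dest: inj_onD)
    moreover have "f x \<in> F" "f y \<in> F" using f xy by (auto dest: bij_betwE)
    ultimately have "f x \<in> kneser_verts n r" "f y \<in> kneser_verts n r" "f x \<inter> f y = {}"
      using F(1) pairwiseD[OF F(4)] by (auto simp: disjnt_def)
    then show "{f x, f y} \<in> kneser_edges n r" by (auto simp: kneser_edges_def)
  qed
qed

text \<open>Exchange the two colours. The resulting symmetry of Ramsey numbers is what the diagonal
  case of the theorem rests on.\<close>

lemma arrows_commute: "arrows V E s t \<longleftrightarrow> arrows V E t s"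
proof -
  have "arrows V E t s" if *: "arrows V E s t" for s t
    unfolding arrows_def
  proof
    fix c :: "'a set \<Rightarrow> colour"
    define c' where "c' e = (case c e of Red \<Rightarrow> Blue | Blue \<Rightarrow> Red)" for e
    have "c' e = Red \<longleftrightarrow> c e = Blue" "c' e = Blue \<longleftrightarrow> c e = Red" for e
      by (auto simp: c'_def split: colour.splits)
    then have "mono_clique V E c' Red k = mono_clique V E c Blue k"
      "mono_clique V E c' Blue k = mono_clique V E c Red k" for k
      by (simp_all add: mono_clique_def)
    moreover have "mono_clique V E c' Red s \<or> mono_clique V E c' Blue t"
      using * by (simp add: arrows_def)
    ultimately show "mono_clique V E c Red t \<or> mono_clique V E c Blue s" by blast
  qed
  then show ?thesis by blast
qed

lemma ramsey_number_commute: "ramsey_number s t = ramsey_number t s"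
  by (simp add: ramsey_number_def arrows_commute[of _ _ s t])

lemma ramsey_number_pos:
  assumes "s > 0" "t > 0"
  shows "ramsey_number s t > 0"
proof (rule ccontr)
  assume "\<not> ramsey_number s t > 0"
  then have "arrows ({} :: nat set) (nsets {} 2) s t"
    using arrows_ramsey_number[of s t] by simp
  with assms show False
    by (auto simp: arrows_def mono_clique_def nsets_def)
qed

lemma kneser_ramsey_number_le:
  assumes s: "s > 0" and t: "t > 1" and r: "r > 0"
    and le: "ramsey_number s (t - 1) \<le> ramsey_number (s - 1) t"
  shows "kneser_ramsey_number r s t
           \<le> (ramsey_number (s - 1) t + 1) * r + ramsey_number s (t - 1) - 1"
proof -
  let ?M = "ramsey_number (s - 1) t" and ?m = "ramsey_number s (t - 1)"
  define n where "n = (?M + 1) * r + ?m - 1"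
  let ?V = "kneser_verts n r" and ?E = "kneser_edges n r"
  define A where "A = {1..r}"
  define X where "X = {r + 1..n}"
  \<comment> \<open>Positivity of \<open>?m\<close> gives room for \<open>A\<close> in
    \<open>{1..n}\<close> and makes \<open>card X\<close> equal to \<open>?M * r + ?m - 1\<close>,
    with no truncation.\<close>
  have "?m > 0" using s t by (intro ramsey_number_pos) auto
  then have n: "r \<le> n" "?M * r + ?m \<le> Suc (card X)" by (auto simp: n_def X_def)
  have A: "A \<in> ?V" using n(1) by (auto simp: A_def kneser_verts_def nsets_def)
  have XV: "nsets X r \<subseteq> ?V"
    unfolding kneser_verts_def by (rule nsets_mono) (auto simp: X_def)
  have edge: "{A, B} \<in> ?E" and neq: "A \<noteq> B" if "B \<in> nsets X r" for B
  proof -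
    have "A \<inter> B = {}" using that by (force simp: A_def X_def nsets_def)
    then show "{A, B} \<in> ?E" using A XV that unfolding kneser_edges_def by blast
    show "A \<noteq> B" using \<open>A \<inter> B = {}\<close> r by (auto simp: A_def)
  qed
  have "arrows ?V ?E s t"
    unfolding arrows_def
  proof
    fix c
    have "finite X" by (simp add: X_def)
    from disjoint_family_two_colours[OF this le n(2) r, of "\<lambda>B. c {A, B} = Red"]
    consider
      F where "F \<subseteq> nsets X r" "card F = ?M" "finite F" "pairwise disjnt F"
        "\<forall>B \<in> F. c {A, B} = Red"
      | F where "F \<subseteq> nsets X r" "card F = ?m" "finite F" "pairwise disjnt F"
        "\<forall>B \<in> F. c {A, B} \<noteq> Red"
      by auto
    then show "mono_clique ?V ?E c Red s \<or> mono_clique ?V ?E c Blue t"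
    proof cases
      case 1
      have FV: "F \<subseteq> ?V" using 1(1) XV by blast
      have "mono_clique F ?E c Red (s - 1) \<or> mono_clique F ?E c Blue t"
        using arrows_disjoint_family[OF FV 1(2-4)] unfolding arrows_def by blast
      \<comment> \<open>Every edge from \<open>A\<close> to \<open>F\<close> is red, so
        \<open>A\<close> completes a red clique on \<open>s - 1\<close> vertices of
        \<open>F\<close>; a blue clique on \<open>t\<close> vertices is already as wanted.\<close>
      moreover have "mono_clique ?V ?E c Red (Suc (s - 1))"
        if "mono_clique F ?E c Red (s - 1)"
        using 1 edge neq by (intro mono_clique_insert[OF that FV A]) blast+
      ultimately show ?thesis using mono_clique_mono[OF _ FV] s by auto
    next
      case 2
      have FV: "F \<subseteq> ?V" using 2(1) XV by blast
      have "mono_clique F ?E c Red s \<or> mono_clique F ?E c Blue (t - 1)"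
        using arrows_disjoint_family[OF FV 2(2-4)] unfolding arrows_def by blast
      moreover have "mono_clique ?V ?E c Blue (Suc (t - 1))"
        if "mono_clique F ?E c Blue (t - 1)"
      proof (rule mono_clique_insert[OF that FV A])
        show "A \<notin> F" using 2(1) neq by blast
        show "{A, B} \<in> ?E \<and> c {A, B} = Blue" if "B \<in> F" for B
          using that 2(1,5) edge by (cases "c {A, B}") auto
      qed
      ultimately show ?thesis using mono_clique_mono[OF _ FV] t by auto
    qed
  qed
  then show ?thesis
    unfolding kneser_ramsey_number_def n_def by (rule Least_le)
qed

theorem theorem1p7:
  shows "(\<forall>s t M m :: nat. 3 \<le> s \<longrightarrow> 3 \<le> t \<longrightarrow>
            M = ramsey_number (s - 1) t \<longrightarrow> m = ramsey_number s (t - 1) \<longrightarrow> m \<le> M \<longrightarrow>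
            (\<forall>r \<ge> 1. kneser_ramsey_number r s t \<le> (M + 1) * r + m - 1)) \<and>
         (\<forall>s r :: nat. 3 \<le> s \<longrightarrow> 1 \<le> r \<longrightarrow>
            kneser_ramsey_number r s s
              \<le> (ramsey_number s (s - 1) + 1) * r + ramsey_number s (s - 1) - 1)"
proof (intro conjI allI impI)
  fix s t M m r :: nat
  assume "3 \<le> s" "3 \<le> t" "M = ramsey_number (s - 1) t" "m = ramsey_number s (t - 1)"
    "m \<le> M" "1 \<le> r"
  then show "kneser_ramsey_number r s t \<le> (M + 1) * r + m - 1"
    using kneser_ramsey_number_le[of s t r] by simp
next
  fix s r :: nat
  assume "3 \<le> s" "1 \<le> r"
  then show "kneser_ramsey_number r s s
      \<le> (ramsey_number s (s - 1) + 1) * r + ramsey_number s (s - 1) - 1"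
    \<comment> \<open>For \<open>t = s\<close> symmetry turns the hypothesis comparing the two
      Ramsey numbers into an equality.\<close>
    using kneser_ramsey_number_le[of s s r] ramsey_number_commute[of s "s - 1"] by simp
qed

end
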